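(* Let $K$ be a kernel such that: $K\in C([0,\infty)\times[0,\infty))$ with $K(x,y)=K(y,x)\ge 0$ for all $x,y\in[0,\infty)$; $K(ax,ay)=aK(x,y)$ for all $x,y\in(0,\infty)$ and $a>0$; there are $\beta_0>0$ and $\alpha\in(0,1)$ with $\lim_{\xi\to0}\frac{K(1,\xi)-1}{\xi^\alpha}=\beta_0$; and there is $k_0>0$ with $K(1,\xi)\ge k_0$ for all $\xi\ge0$. Then there exists $\rho_{**}\ge\rho_*$ such that for every $\rho>\rho_{**}$ and for $b=\frac{1+\rho}{\rho}$ the unique weak solution $g\in\mathcal{M}^+([0,\infty))$, with unit mass $\int_{[0,\infty)}g(x)\,\mathrm{d}x=1$, of the equation $$b\,x\,g(x)=\int_0^x\int_{x-y}^\infty \frac{K(y,z)}{z}\,g(y)g(z)\,\mathrm{d}z\,\mathrm{d}y$$ is the Dirac delta $\delta_0$ at the origin.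
   Context: $\mathcal{M}^+([0,\infty))$ is the set of positive Radon measures on $[0,\infty)$; for such a measure $g$ (possibly not absolutely continuous) and $A\subset[0,\infty)$, $\int_A\theta(x)g(x)\,\mathrm{d}x$ denotes the integral of $\theta$ over $A$ with respect to $g$. A measure $g\in\mathcal{M}^+([0,\infty))$ is a weak solution of the equation if for every test function $\theta\in C([0,\infty))$ with compact support $$b\int_{[0,\infty)}x\theta(x)g(x)\,\mathrm{d}x=\int_{[0,\infty)}\int_{[0,\infty)}\frac{K(y,z)}{z}g(y)g(z)\int_y^{y+z}\theta(x)\,\mathrm{d}x\,\mathrm{d}y\,\mathrm{d}z,$$ where for $z=0$ the quantity $\frac1z\int_y^{y+z}\theta(x)\,\mathrm{d}x$ is understood as its limit $\theta(y)$. The constant $\rho_*>0$ is a fixed number (depending on $K$) with the property that for every $\rho\in(0,\rho_* )$ and $b=\frac{1+\rho}{\rho}$ there is a positive solution $g\in C^1((0,\infty))$ of the equation (holding pointwise for all $x>0$) with $\int_0^\infty g(x)\,\mathrm{d}x=1$, with $g(x)$ bounded above and below by positive multiples of $x^{-\frac1{1+\rho}}$ as $x\to0$ and of $x^{-(1+\rho)}$ as $x\to\infty$. (Such a $\rho_*$ exists for kernels as in the claim.) *)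

theory Defs
  imports "HOL-Probability.Probability"
begin

abbreviation half_line :: "real measure" where
  "half_line \<equiv> restrict_space borel {0..}"

text \<open>On the half-line every Borel measure that is finite on compact sets is automatically
  regular, so regularity need not be demanded separately.\<close>
definition radon_measures :: "real measure set" where
  "radon_measures = {g. sets g = sets half_line \<and>
     (\<forall>C. compact C \<longrightarrow> C \<subseteq> {0..} \<longrightarrow> emeasure g C < \<infinity>)}"

definition delta0 :: "real measure" where
  "delta0 = return half_line 0"

definition test_function :: "(real \<Rightarrow> real) \<Rightarrow> bool" where
  "test_function \<theta> \<longleftrightarrow> continuous_on {0..} \<theta> \<and> compact (closure {x \<in> {0..}. \<theta> x \<noteq> 0})"

text \<open>The quantity \<open>1/z * \<integral>_y^{y+z} \<theta>\<close>, read as its limit \<open>\<theta> y\<close> for \<open>z = 0\<close>.\<close>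
definition average :: "(real \<Rightarrow> real) \<Rightarrow> real \<Rightarrow> real \<Rightarrow> real" where
  "average \<theta> y z = (if z = 0 then \<theta> y else 1 / z * integral {y..y+z} \<theta>)"

text \<open>The existence of the double integral is part of the notion, since a non-integrable
  function has Bochner integral 0 here. It is automatic for measures of finite mass and kernels
  that are continuous and homogeneous of degree 1: the integrand is then bounded.\<close>
definition weak_solution :: "(real \<Rightarrow> real \<Rightarrow> real) \<Rightarrow> real \<Rightarrow> real measure \<Rightarrow> bool" where
  "weak_solution K b g \<longleftrightarrow> (\<forall>\<theta>. test_function \<theta> \<longrightarrow>
     integrable (g \<Otimes>\<^sub>M g) (\<lambda>(y, z). K y z * average \<theta> y z) \<and>
     b * (\<integral>x. x * \<theta> x \<partial>g) = (\<integral>z. (\<integral>y. K y z * average \<theta> y z \<partial>g) \<partial>g))"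

text \<open>Positive classical solutions, with density \<open>g\<close> on the open half-line. All integrands are
  non-negative, so the integrals are taken in \<open>[0, \<infinity>]\<close>; the equations force them to be finite.\<close>
definition classical_solution :: "(real \<Rightarrow> real \<Rightarrow> real) \<Rightarrow> real \<Rightarrow> (real \<Rightarrow> real) \<Rightarrow> bool" where
  "classical_solution K b g \<longleftrightarrow>
     g C1_differentiable_on {0<..} \<and> (\<forall>x>0. 0 < g x) \<and>
     (\<forall>x>0. ennreal (b * x * g x) =
        (\<integral>\<^sup>+y\<in>{0<..<x}. (\<integral>\<^sup>+z\<in>{x - y<..}. ennreal (K y z / z * g y * g z) \<partial>lborel) \<partial>lborel))"

definition rho_star_property :: "(real \<Rightarrow> real \<Rightarrow> real) \<Rightarrow> real \<Rightarrow> bool" where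
  "rho_star_property K \<rho>\<^sub>0 \<longleftrightarrow> (\<forall>\<rho>. 0 < \<rho> \<and> \<rho> < \<rho>\<^sub>0 \<longrightarrow>
     (\<exists>g. classical_solution K ((1 + \<rho>) / \<rho>) g \<and>
       (\<integral>\<^sup>+x\<in>{0<..}. ennreal (g x) \<partial>lborel) = 1 \<and>
       g \<in> \<Theta>[at_right 0](\<lambda>x. x powr (- (1 / (1 + \<rho>)))) \<and>
       g \<in> \<Theta>[at_top](\<lambda>x. x powr (- (1 + \<rho>)))))"

end

(* Let phi(x) = min(x, R)^m = x theta(x), and write F(y, z) = K(y, z) * average theta y z, so that
   the equation tested with theta reads b * int phi dg = double integral of F.
   Since alpha < 1, the hypothesis at 0 gives K(x, s) >= x + s for s <= eps x. As t theta(t) is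
   increasing, F(x, s) >= phi(x) there, and F(s, x) >= integral of theta over [s, s + x], which is
   nearly phi(x)/m. For eps x <= s <= x with x + s <= R one has instead
   F(s, x) >= k0 * ((x + s)^m - s^m)/m, exponentially large in m compared with phi(x).
   Hence, for m large depending on eps and k0 only,
     F(x, s) + F(s, x) >= (1 + 1/(4m)) (phi(x) + phi(s))  whenever s <= x and s <= eps R/2.
   Integrating over the pairs with one entry <= eps R/2 yields
     b * int phi dg >= (1 + 1/(4m)) g([0, eps R/2]) int phi dg.
   Letting R tend to infinity, b < 1 + 1/(4m), that is rho > 4m, forces int phi dg = 0. *)

theory Submission
  imports Defs "HOL-Real_Asymp.Real_Asymp"
begin

section \<open>Truncated powers and elementary integral estimates\<close>

text \<open>This is \<open>x ^ k\<close> up to \<open>R\<close> and \<open>R ^ Suc k / x\<close> beyond, so that \<open>x * capped_power k R x\<close>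
  is bounded and no moment of the measure has to be assumed finite.\<close>
definition capped_power :: "nat \<Rightarrow> real \<Rightarrow> real \<Rightarrow> real" where
  "capped_power k R x = min x R ^ k * (R / max x R)"

lemma capped_power_eq_power: "0 < R \<Longrightarrow> x \<le> R \<Longrightarrow> capped_power k R x = x ^ k"
  by (simp add: capped_power_def max_def)

lemma mult_capped_power: "0 < R \<Longrightarrow> x * capped_power k R x = min x R ^ Suc k"
  by (auto simp: capped_power_def min_def max_def)

lemma capped_power_nonneg: "0 < R \<Longrightarrow> 0 \<le> x \<Longrightarrow> 0 \<le> capped_power k R x"
  by (auto simp: capped_power_def)

lemma continuous_on_capped_power: "0 < R \<Longrightarrow> continuous_on S (capped_power k R)"
  unfolding capped_power_def by (intro continuous_intros) auto

lemma integral_mono_subinterval: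
  fixes f :: "real \<Rightarrow> real"
  assumes "continuous_on {c..d} f" and "\<And>x. x \<in> {c..d} \<Longrightarrow> 0 \<le> f x" and "c \<le> a" and "b \<le> d"
  shows "integral {a..b} f \<le> integral {c..d} f"
proof (rule integral_subset_le)
  show "{a..b} \<subseteq> {c..d}" using assms by auto
  then show "f integrable_on {a..b}"
    using assms(1) continuous_on_subset integrable_continuous_interval by blast
qed (use assms in \<open>auto intro: integrable_continuous_interval\<close>)

lemma integral_power_interval:
  fixes a b :: real
  assumes "a \<le> b"
  shows "integral {a..b} (\<lambda>x. x ^ k) = (b ^ Suc k - a ^ Suc k) / Suc k"
proof -
  have "((\<lambda>x. x ^ k) has_integral b ^ Suc k / Suc k - a ^ Suc k / Suc k) {a..b}"
  proof (rule fundamental_theorem_of_calculus[OF assms])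
    fix x :: real
    have "((\<lambda>x. x ^ Suc k / Suc k) has_real_derivative x ^ k) (at x within {a..b})"
      by (auto intro!: derivative_eq_intros simp del: power_Suc)
    then show "((\<lambda>x. x ^ Suc k / Suc k) has_vector_derivative x ^ k) (at x within {a..b})"
      by (simp add: has_real_derivative_iff_has_vector_derivative)
  qed
  then show ?thesis by (simp add: integral_unique diff_divide_distrib)
qed

text \<open>The two sides differ by \<open>b * (a ^ k - b ^ k)\<close>. Keeping the full power of
  the larger endpoint is what later produces the factor \<open>(1 + \<epsilon>) ^ k\<close>.\<close>

lemma diff_power_ge:
  fixes a b :: real
  assumes "0 \<le> b" and "b \<le> a"
  shows "(a - b) * a ^ k \<le> a ^ Suc k - b ^ Suc k"
proof -
  have "b * b ^ k \<le> b * a ^ k" using assms by (intro mult_left_mono power_mono)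
  then show ?thesis by (simp add: algebra_simps)
qed

section \<open>Kernel bound near the axis and choice of the exponent\<close>

text \<open>Near 0 the excess \<open>K 1 \<xi> - 1\<close> is at least
  \<open>\<beta> / 2 * \<xi> powr \<alpha>\<close>, which dominates \<open>\<xi>\<close> because
  \<open>\<alpha> < 1\<close>. Homogeneity with \<open>\<xi> = s / x\<close> carries this over to
  all pairs of small positive ratio.\<close>

lemma kernel_ge_sum_near_axis:
  fixes K :: "real \<Rightarrow> real \<Rightarrow> real"
  assumes cont: "continuous_on ({0..} \<times> {0..}) (\<lambda>(x, y). K x y)"
    and hom: "\<And>a x y. 0 < a \<Longrightarrow> 0 < x \<Longrightarrow> 0 < y \<Longrightarrow> K (a * x) (a * y) = a * K x y"
    and pos: "0 < \<beta>" "\<alpha> < 1"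
    and lim: "((\<lambda>\<xi>. (K 1 \<xi> - 1) / \<xi> powr \<alpha>) \<longlongrightarrow> \<beta>) (at_right 0)"
  obtains \<epsilon> where "0 < \<epsilon>" "\<epsilon> \<le> 1/2" "\<And>x s. 0 < x \<Longrightarrow> 0 \<le> s \<Longrightarrow> s \<le> \<epsilon> * x \<Longrightarrow> x + s \<le> K x s"
proof -
  have "\<forall>\<^sub>F \<xi> in at_right 0. (K 1 \<xi> - 1) / \<xi> powr \<alpha> > \<beta> / 2"
    using lim pos by (intro order_tendstoD) auto
  moreover have "\<forall>\<^sub>F \<xi> in at_right (0::real). \<xi> powr (1 - \<alpha>) < \<beta> / 2"
  proof -
    have "((\<lambda>\<xi>::real. \<xi> powr (1 - \<alpha>)) \<longlongrightarrow> 0) (at_right 0)"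
      using pos by real_asymp
    then show ?thesis using pos by (intro order_tendstoD) auto
  qed
  moreover have "\<forall>\<^sub>F \<xi> in at_right (0::real). 0 < \<xi>"
    by (simp add: eventually_at_right_less)
  ultimately have "\<forall>\<^sub>F \<xi> in at_right 0. 1 + \<xi> \<le> K 1 \<xi>"
  proof eventually_elim
    case (elim \<xi>)
    have "\<xi> = \<xi> powr (1 - \<alpha>) * \<xi> powr \<alpha>" using elim by (simp flip: powr_add)
    also have "\<dots> \<le> \<beta> / 2 * \<xi> powr \<alpha>" using elim by (intro mult_right_mono) auto
    also have "\<dots> \<le> K 1 \<xi> - 1" using elim by (simp add: field_simps)
    finally show ?case by simp
  qed
  then obtain d where d: "0 < d" "\<And>\<xi>. 0 < \<xi> \<Longrightarrow> \<xi> < d \<Longrightarrow> 1 + \<xi> \<le> K 1 \<xi>"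
    unfolding eventually_at_right_field by auto
  \<comment> \<open>Halving \<open>d\<close> puts the closed range
    \<open>s / x \<le> \<epsilon>\<close> inside the open interval where the bound holds; the cap
    1/2 is used in the choice of the exponent.\<close>
  define \<epsilon> where "\<epsilon> = min (d / 2) (1 / 2)"
  have \<epsilon>: "0 < \<epsilon>" "\<epsilon> \<le> 1/2" "\<epsilon> < d" using d by (auto simp: \<epsilon>_def)
  have off: "x + s \<le> K x s" if "0 < x" "0 < s" "s \<le> \<epsilon> * x" for x s
  proof -
    have "s / x < d" using that \<epsilon> by (simp add: field_simps) (smt (verit) mult_strict_right_mono)
    then have "1 + s / x \<le> K 1 (s / x)" using that by (intro d) auto
    then have "x * (1 + s / x) \<le> x * K 1 (s / x)" using that by (intro mult_left_mono) auto
    also have "\<dots> = K x s" using hom[of x 1 "s / x"] that by simp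
    finally show ?thesis using that by (simp add: distrib_left)
  qed
  \<comment> \<open>Homogeneity is assumed for positive arguments only, so the value at
    \<open>s = 0\<close> is reached by continuity, as a limit over small
    \<open>s > 0\<close>.\<close>
  have axis: "x \<le> K x 0" if "0 < x" for x
  proof -
    have "continuous_on {0..} (\<lambda>s. K x s)"
    proof -
      have "continuous_on {0..} ((\<lambda>(x, y). K x y) \<circ> (\<lambda>s. (x, s)))"
        by (rule continuous_on_compose)
          (use that in \<open>auto intro!: continuous_intros continuous_on_subset[OF cont]\<close>)
      then show ?thesis by (simp add: o_def)
    qed
    then have "((\<lambda>s. K x s) \<longlongrightarrow> K x 0) (at 0 within {0..})"
      by (simp add: continuous_on)
    then have "((\<lambda>s. K x s) \<longlongrightarrow> K x 0) (at_right 0)"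
      by (rule tendsto_within_subset) auto
    moreover have "\<forall>\<^sub>F s in at_right 0. x \<le> K x s"
    proof -
      have "\<forall>\<^sub>F s in at_right 0. 0 < s \<and> s < \<epsilon> * x"
        unfolding eventually_at_right_field using \<epsilon> that by (intro exI[of _ "\<epsilon> * x"]) auto
      then show ?thesis
      proof eventually_elim
        case (elim s)
        then show ?case using off[of x s] that by auto
      qed
    qed
    ultimately show ?thesis by (intro tendsto_lowerbound[of "\<lambda>s. K x s" _ "at_right 0"]) auto
  qed
  show thesis
  proof (rule that[OF \<epsilon>(1,2)])
    fix x s :: real assume "0 < x" "0 \<le> s" "s \<le> \<epsilon> * x"
    then show "x + s \<le> K x s" using off[of x s] axis[of x] by (cases "s = 0") auto
  qed
qed

text \<open>Exponential against linear growth gives both bounds for all large \<open>k\<close>. The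
  first lets \<open>(1 + \<epsilon>) ^ k\<close> pay for a factor \<open>Suc k\<close> lost by
  integrating a power; the second makes the power of an entry \<open>s \<le> \<epsilon> * x\<close>
  small against \<open>1 / Suc k\<close>.\<close>

lemma exponent_exists:
  fixes \<epsilon> k\<^sub>0 :: real
  assumes "0 < \<epsilon>" "\<epsilon> \<le> 1/2" "0 < k\<^sub>0"
  obtains k :: nat where "4 * real (Suc k) \<le> k\<^sub>0 * (1 + \<epsilon>) ^ k" "\<epsilon> ^ Suc k \<le> 1 / (8 * real (Suc k))"
proof -
  have "(\<lambda>k. (1 + real k) / (1 + \<epsilon>) ^ k) \<longlonglongrightarrow> 0" using assms by real_asymp
  then have "\<forall>\<^sub>F k in sequentially. (1 + real k) / (1 + \<epsilon>) ^ k < k\<^sub>0 / 4"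
    using assms by (intro order_tendstoD) auto
  moreover have "\<forall>\<^sub>F k in sequentially. (1 + real k) * (1/2) ^ Suc k < 1 / 8"
  proof -
    have "(\<lambda>k. (1 + real k) * (1/2) ^ Suc k) \<longlonglongrightarrow> 0" by real_asymp
    then show ?thesis by (rule order_tendstoD) simp
  qed
  ultimately have "\<forall>\<^sub>F k in sequentially. 4 * real (Suc k) \<le> k\<^sub>0 * (1 + \<epsilon>) ^ k
      \<and> \<epsilon> ^ Suc k \<le> 1 / (8 * real (Suc k))"
  proof eventually_elim
    case (elim k)
    have "0 < (1 + \<epsilon>) ^ k" using assms by simp
    then have "4 * real (Suc k) \<le> k\<^sub>0 * (1 + \<epsilon>) ^ k" using elim by (simp add: field_simps)
    moreover have "\<epsilon> ^ Suc k \<le> (1/2) ^ Suc k" using assms by (intro power_mono) auto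
    moreover have "(1/2) ^ Suc k \<le> 1 / (8 * real (Suc k))"
      using elim by (simp add: field_simps del: power_Suc)
    ultimately show ?case using elim by (metis order_trans)
  qed
  then obtain k where "4 * real (Suc k) \<le> k\<^sub>0 * (1 + \<epsilon>) ^ k \<and> \<epsilon> ^ Suc k \<le> 1 / (8 * real (Suc k))"
    using eventually_happens trivial_limit_sequentially by blast
  then show thesis using that by blast
qed

section \<open>Pointwise lower bound for the symmetrised integrand\<close>

lemma average_cong:
  assumes "0 \<le> z" and "\<And>t. y \<le> t \<Longrightarrow> t \<le> y + z \<Longrightarrow> f t = f' t"
  shows "average f y z = average f' y z"
proof -
  have "integral {y..y+z} f = integral {y..y+z} f'"
    using assms(2) by (intro Henstock_Kurzweil_Integration.integral_cong) auto
  then show ?thesis using assms by (auto simp: average_def)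
qed

lemma average_nonneg:
  assumes "0 \<le> y" "0 \<le> z" "continuous_on {0..} f" "\<And>t. 0 \<le> t \<Longrightarrow> 0 \<le> f t"
  shows "0 \<le> average f y z"
proof -
  have "f integrable_on {y..y+z}"
    using assms by (intro integrable_continuous_interval) (auto intro: continuous_on_subset)
  then have "0 \<le> integral {y..y+z} f"
    using assms by (intro Henstock_Kurzweil_Integration.integral_nonneg) auto
  then show ?thesis
    using assms(1,2,4) by (simp add: average_def)
qed

text \<open>For \<open>s \<le> \<epsilon> * x\<close> the first product already yields
  \<open>min x R ^ Suc k\<close>, and the second adds nearly the fraction \<open>1 / Suc k\<close>
  of it; for \<open>\<epsilon> * x < s\<close> the second product alone suffices. The restriction
  \<open>s \<le> \<epsilon> * R / 2\<close> serves both ranges: it gives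
  \<open>s \<le> \<epsilon> * R\<close> when \<open>x\<close> exceeds \<open>R\<close> in the first,
  and \<open>x + s \<le> R\<close> in the second.\<close>

lemma capped_power_dominates:
  fixes K :: "real \<Rightarrow> real \<Rightarrow> real"
  assumes sym: "\<And>x y. 0 \<le> x \<Longrightarrow> 0 \<le> y \<Longrightarrow> K x y = K y x \<and> 0 \<le> K x y"
    and near: "\<And>x s. 0 < x \<Longrightarrow> 0 \<le> s \<Longrightarrow> s \<le> \<epsilon> * x \<Longrightarrow> x + s \<le> K x s"
    and below: "\<And>x s. 0 < x \<Longrightarrow> 0 < s \<Longrightarrow> k\<^sub>0 * x \<le> K x s"
    and \<epsilon>: "0 < \<epsilon>" "\<epsilon> \<le> 1/2" and k0: "0 < k\<^sub>0"
    and k: "4 * real (Suc k) \<le> k\<^sub>0 * (1 + \<epsilon>) ^ k" "\<epsilon> ^ Suc k \<le> 1 / (8 * real (Suc k))"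
    and s: "0 \<le> s" "s \<le> x" "s \<le> \<epsilon> * R / 2" and R: "0 < R"
  shows "(1 + 1 / (4 * real (Suc k))) * (min x R ^ Suc k + min s R ^ Suc k)
    \<le> K x s * average (capped_power k R) x s + K s x * average (capped_power k R) s x"
    (is "?lhs \<le> K x s * ?A x s + K s x * ?A s x")
proof -
  let ?f = "capped_power k R" and ?m = "real (Suc k)"
  have avg_nonneg: "0 \<le> ?A y z" if "0 \<le> y" "0 \<le> z" for y z
    using that R by (intro average_nonneg continuous_on_capped_power capped_power_nonneg)
  have nonneg: "0 \<le> K x s * ?A x s" "0 \<le> K s x * ?A s x"
    using avg_nonneg sym[of x s] sym[of s x] s by auto
  have "0 \<le> x" using s by simp
  consider "x = 0" | "0 < x" "s \<le> \<epsilon> * x" | "0 < x" "\<epsilon> * x < s"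
    using \<open>0 \<le> x\<close> by linarith
  then show ?thesis
  proof cases
    case 1
    then have "?lhs = 0" using s R by simp
    then show ?thesis using nonneg by linarith
  next
    case 2
    define M where "M = min x R"
    have M: "0 < M" "M \<le> x" "M \<le> R" using 2 R by (auto simp: M_def)
    have sM: "s \<le> \<epsilon> * M"
    proof -
      have "s \<le> \<epsilon> * R" using s(1,3) by linarith
      then show ?thesis using 2 by (simp add: M_def min_def)
    qed
    have "\<epsilon> * M \<le> 1 * M" using M \<epsilon> by (intro mult_right_mono) auto
    with sM have "s \<le> M" by simp
    have first: "M ^ Suc k \<le> K x s * ?A x s"
    proof (cases "s = 0")
      case True
      have "M ^ Suc k = x * ?f x" unfolding mult_capped_power[OF R] M_def ..
      also have "\<dots> \<le> K x s * ?f x"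
        using near[of x s] 2 s R capped_power_nonneg[of R x k] by (intro mult_right_mono) auto
      finally show ?thesis using True by (simp add: average_def)
    next
      case False
      then have "0 < s" using s by simp
      \<comment> \<open>For \<open>t\<close> in the interval,
        \<open>t * ?f t = min t R ^ Suc k \<ge> M ^ Suc k\<close> and \<open>t \<le> x + s\<close>,
        so \<open>?f\<close> has a constant lower bound whose denominator cancels against
        \<open>near\<close>.\<close>
      have "M ^ Suc k / (x + s) * s = integral {x..x+s} (\<lambda>_. M ^ Suc k / (x + s))"
        using \<open>0 < s\<close> by simp
      also have "\<dots> \<le> integral {x..x+s} ?f"
      proof (intro integral_le)
        fix t assume t: "t \<in> {x..x+s}"
        have "M ^ Suc k \<le> min t R ^ Suc k"
          using t M R by (intro power_mono) (auto simp: M_def)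
        also have "\<dots> = t * ?f t" using mult_capped_power[OF R] by simp
        also have "\<dots> \<le> (x + s) * ?f t"
          using t 2 R capped_power_nonneg[of R t k] by (intro mult_right_mono) auto
        finally show "M ^ Suc k / (x + s) \<le> ?f t" using 2 s by (simp add: field_simps)
      qed (auto intro!: integrable_continuous_interval continuous_on_capped_power R)
      finally have "M ^ Suc k \<le> (x + s) * (1 / s * integral {x..x+s} ?f)"
        using 2 \<open>0 < s\<close> by (simp add: field_simps)
      also have "\<dots> = (x + s) * ?A x s" using \<open>0 < s\<close> by (simp add: average_def)
      also have "\<dots> \<le> K x s * ?A x s"
        using near[of x s] 2 s avg_nonneg[of x s] by (intro mult_right_mono) auto
      finally show ?thesis .
    qed
    \<comment> \<open>Of the interval of integration only \<open>{s..M}\<close> is kept, where the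
      cap is inactive. The length \<open>x\<close> in the average cancels against
      \<open>x \<le> K s x\<close>.\<close>
    have second: "M ^ Suc k * (1 - \<epsilon> ^ Suc k) / ?m \<le> K s x * ?A s x"
    proof -
      have "s ^ Suc k \<le> (\<epsilon> * M) ^ Suc k" using sM s by (intro power_mono) auto
      then have "M ^ Suc k * (1 - \<epsilon> ^ Suc k) \<le> M ^ Suc k - s ^ Suc k"
        by (simp only: power_mult_distrib algebra_simps)
      then have "M ^ Suc k * (1 - \<epsilon> ^ Suc k) / ?m \<le> (M ^ Suc k - s ^ Suc k) / ?m"
        by (intro divide_right_mono) auto
      also have "\<dots> = integral {s..M} (\<lambda>t. t ^ k)"
        using integral_power_interval[OF \<open>s \<le> M\<close>] by simp
      also have "\<dots> = integral {s..M} ?f"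
        using M by (intro Henstock_Kurzweil_Integration.integral_cong) (simp add: capped_power_eq_power)
      also have "\<dots> \<le> integral {s..s+x} ?f"
        using R s M by (intro integral_mono_subinterval continuous_on_capped_power)
          (auto intro: capped_power_nonneg)
      also have "\<dots> = x * ?A s x" using 2 by (simp add: average_def)
      also have "\<dots> \<le> K s x * ?A s x"
        using near[of x s] 2 s sym[of x s] avg_nonneg[of s x] by (intro mult_right_mono) auto
      finally show ?thesis .
    qed
    have "min s R ^ Suc k \<le> (\<epsilon> * M) ^ Suc k"
      using sM s R by (intro power_mono) auto
    also have "\<dots> \<le> M ^ Suc k * (1 / (8 * ?m))"
      unfolding power_mult_distrib using k(2) M by (simp only: mult.commute) (intro mult_left_mono, auto)
    finally have "?lhs \<le> (1 + 1 / (4 * ?m)) * (M ^ Suc k + M ^ Suc k * (1 / (8 * ?m)))"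
      unfolding M_def by (intro mult_left_mono add_left_mono) auto
    also have "\<dots> = M ^ Suc k * ((1 + 1 / (4 * ?m)) * (1 + 1 / (8 * ?m)))"
      by (simp only: algebra_simps)
    also have "\<dots> \<le> M ^ Suc k * (1 + (1 - 1 / (8 * ?m)) / ?m)"
    proof (intro mult_left_mono)
      have "1 \<le> ?m" by simp
      \<comment> \<open>In terms of \<open>w\<close> the claim reads 1 + 3w/8 + w^2/32 \<le> 1 + w -
        w^2/8, which follows from w^2 \<le> w.\<close>
      define w where "w = 1 / ?m"
      have w: "0 \<le> w" "w \<le> 1" using \<open>1 \<le> ?m\<close> by (auto simp: w_def)
      have "w * w \<le> w" using w by (simp add: mult_left_le)
      then have "(1 + w / 4) * (1 + w / 8) \<le> 1 + (1 - w / 8) * w"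
        using w by (simp add: algebra_simps)
      then show "(1 + 1 / (4 * ?m)) * (1 + 1 / (8 * ?m)) \<le> 1 + (1 - 1 / (8 * ?m)) / ?m"
        by (simp add: w_def mult.commute)
    qed (use M in auto)
    also have "\<dots> \<le> M ^ Suc k + M ^ Suc k * (1 - \<epsilon> ^ Suc k) / ?m"
    proof -
      have "M ^ Suc k * ((1 - 1 / (8 * ?m)) / ?m) \<le> M ^ Suc k * ((1 - \<epsilon> ^ Suc k) / ?m)"
        using k(2) M by (intro mult_left_mono divide_right_mono) auto
      then show ?thesis by (simp add: distrib_left)
    qed
    also have "\<dots> \<le> K x s * ?A x s + K s x * ?A s x" using first second by linarith
    finally show ?thesis .
  next
    case 3
    have "0 < s" using 3 \<epsilon> by (smt (verit) mult_pos_pos)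
    \<comment> \<open>Comparing the two bounds on \<open>s\<close> places all of
      \<open>{s..s+x}\<close> below \<open>R\<close>, so the capped power is a plain power
      there.\<close>
    have "\<epsilon> * x < \<epsilon> * (R / 2)" using 3 s by simp
    then have "x < R / 2" using \<epsilon> by (simp only: mult_less_cancel_left_pos)
    then have xs: "x + s \<le> R" using s by linarith
    have "?lhs \<le> 2 * (x ^ Suc k + x ^ Suc k)"
    proof (intro mult_mono add_mono)
      show "min x R ^ Suc k \<le> x ^ Suc k" "min s R ^ Suc k \<le> x ^ Suc k"
        using s R by (auto intro!: power_mono simp del: power_Suc)
    qed (use s R in \<open>auto simp: field_simps\<close>)
    \<comment> \<open>The factor \<open>?m / ?m\<close> is inserted so that the hypothesis on
      \<open>k\<close> can trade \<open>4 * ?m\<close> for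
      \<open>k\<^sub>0 * (1 + \<epsilon>) ^ k\<close>; then \<open>\<epsilon> * x < s\<close> bounds
      \<open>(1 + \<epsilon>) * x\<close> by \<open>s + x\<close>.\<close>
    also have "\<dots> = 4 * ?m * x ^ Suc k / ?m" by (simp del: of_nat_Suc)
    also have "\<dots> \<le> k\<^sub>0 * (1 + \<epsilon>) ^ k * x ^ Suc k / ?m"
      using k(1) 3 by (intro divide_right_mono mult_right_mono) auto
    also have "\<dots> = k\<^sub>0 * (x * ((1 + \<epsilon>) * x) ^ k) / ?m" by (simp add: power_mult_distrib)
    also have "\<dots> \<le> k\<^sub>0 * (x * (s + x) ^ k) / ?m"
      using k0 3 \<epsilon> by (intro divide_right_mono mult_left_mono power_mono) (auto simp: algebra_simps)
    also have "\<dots> \<le> k\<^sub>0 * ((s + x) ^ Suc k - s ^ Suc k) / ?m"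
      using diff_power_ge[of s "s + x" k] s k0 3 by (intro divide_right_mono mult_left_mono) auto
    also have "\<dots> = k\<^sub>0 * integral {s..s+x} (\<lambda>t. t ^ k)"
      using integral_power_interval[of s "s + x" k] 3 by simp
    also have "\<dots> = k\<^sub>0 * integral {s..s+x} ?f"
      using xs R by (intro arg_cong[where f = "(*) k\<^sub>0"] Henstock_Kurzweil_Integration.integral_cong)
        (simp add: capped_power_eq_power)
    also have "\<dots> = k\<^sub>0 * x * ?A s x" using 3 by (simp add: average_def)
    also have "\<dots> \<le> K s x * ?A s x"
      using below[of x s] 3 \<open>0 < s\<close> sym[of x s] avg_nonneg[of s x] s by (intro mult_right_mono) auto
    finally show ?thesis using nonneg by linarith
  qed
qed

section \<open>Testing the equation and symmetrising\<close>

text \<open>Equal to 1 up to \<open>L\<close>, linear down to 0 at \<open>L + 1\<close>, and 0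
  beyond. It supplies the compact support that the capped power lacks.\<close>

definition cutoff :: "real \<Rightarrow> real \<Rightarrow> real" where
  "cutoff L x = max 0 (min 1 (L + 1 - x))"

lemma test_function_cutoff:
  assumes "continuous_on {0..} f"
  shows "test_function (\<lambda>x. f x * cutoff L x)"
proof -
  have "bounded {x \<in> {0..}. f x * cutoff L x \<noteq> 0}"
    by (rule bounded_subset[of "{0..L + 1}"]) (auto simp: cutoff_def)
  then show ?thesis
    unfolding test_function_def cutoff_def
    by (auto intro!: continuous_intros assms)
qed

lemma measurable_ident_half_line:
  "sets g = sets half_line \<Longrightarrow> (\<lambda>x. x) \<in> borel_measurable g"
  by (simp cong: measurable_cong_sets add: measurable_restrict_space1)

lemma space_eq_half_line: "sets g = sets half_line \<Longrightarrow> space g = {0..}"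
  by (drule sets_eq_imp_space_eq) (simp add: space_restrict_space)

text \<open>The equation is tested with the capped power times a cutoff and its double integral is
  symmetrised, so that \<open>dominates\<close> applies to the pairs whose smaller entry is at most
  \<open>a\<close>. All other pairs contribute a non-negative amount and are dropped.\<close>

lemma weak_solution_capped_moment_ge:
  fixes K :: "real \<Rightarrow> real \<Rightarrow> real"
  assumes sets_g: "sets g = sets half_line" and prob: "prob_space g"
    and weak: "weak_solution K b g"
    and K: "\<And>x y. 0 \<le> x \<Longrightarrow> 0 \<le> y \<Longrightarrow> 0 \<le> K x y"
    and nonneg: "0 \<le> b" "0 \<le> C" "0 \<le> a" and R: "0 < R"
    and dominates: "\<And>x s. 0 \<le> s \<Longrightarrow> s \<le> x \<Longrightarrow> s \<le> a \<Longrightarrow>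
      C * (min x R ^ Suc k + min s R ^ Suc k)
      \<le> K x s * average (capped_power k R) x s + K s x * average (capped_power k R) s x"
  shows "C * measure g {0..a} * (\<integral>x. min x R ^ Suc k \<partial>g) \<le> b * (\<integral>x. min x R ^ Suc k \<partial>g)"
proof -
  interpret prob_space g by (fact prob)
  interpret pair_sigma_finite g g ..
  interpret P: pair_prob_space g g ..
  note [measurable] = measurable_ident_half_line[OF sets_g]
  have space_g: "space g = {0..}" by (rule space_eq_half_line[OF sets_g])
  define \<phi> where "\<phi> x = min x R ^ Suc k" for x
  have \<phi>_meas [measurable]: "\<phi> \<in> borel_measurable g" unfolding \<phi>_def by measurable
  have \<phi>_bounds: "0 \<le> \<phi> x" "\<phi> x \<le> R ^ Suc k" if "0 \<le> x" for x
    unfolding \<phi>_def using that R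
    by (auto intro!: power_mono zero_le_power simp del: power_Suc)
  have \<phi>_int: "integrable g \<phi>"
    by (rule integrable_const_bound[of _ "R ^ Suc k"])
      (use \<phi>_bounds space_g in auto)
  have bound: "C * measure g {0..a} * (\<integral>x. indicator {..L} x * \<phi> x \<partial>g) \<le> b * (\<integral>x. \<phi> x \<partial>g)"
    if "a \<le> L" for L
  proof -
    \<comment> \<open>For \<open>z \<le> y \<le> L\<close> both averages run over intervals ending
      at \<open>y + z \<le> 2 * L\<close>, where this cutoff is 1.\<close>
    let ?\<theta> = "\<lambda>x. capped_power k R x * cutoff (2 * L) x"
    define F where "F y z = K y z * average ?\<theta> y z" for y z
    \<comment> \<open>The product \<open>h y * i z\<close> makes the lower bound factorise: its
      integral is a truncated moment times the mass of \<open>{0..a}\<close>.\<close>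
    define h where "h x = indicator {..L} x * \<phi> x" for x
    define i :: "real \<Rightarrow> real" where "i = indicator {..a}"
    have h_meas: "h \<in> borel_measurable g" and i_meas: "i \<in> borel_measurable g"
      unfolding h_def i_def by measurable
    have h_bounds: "0 \<le> h x" "h x \<le> R ^ Suc k" "h x \<le> \<phi> x" if "0 \<le> x" for x
    proof -
      have "h x = 0 \<or> h x = \<phi> x" unfolding h_def indicator_def by simp
      moreover have "0 \<le> R ^ Suc k" using R by (intro zero_le_power) simp
      ultimately have "0 \<le> h x \<and> h x \<le> R ^ Suc k \<and> h x \<le> \<phi> x"
        using \<phi>_bounds[OF that] by linarith
      then show "0 \<le> h x" "h x \<le> R ^ Suc k" "h x \<le> \<phi> x" by blast+
    qed
    have hi_int: "integrable (g \<Otimes>\<^sub>M g) (\<lambda>(y, z). h y * i z)"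
    proof (rule P.integrable_const_bound[of _ "R ^ Suc k"])
      have "norm (h y * i z) \<le> R ^ Suc k" if "0 \<le> y" for y z
      proof -
        have "norm (h y * i z) \<le> h y"
          using h_bounds(1)[OF that] by (simp add: i_def indicator_def)
        then show ?thesis using h_bounds(2)[OF that] by (rule order_trans)
      qed
      then show "AE x in g \<Otimes>\<^sub>M g. norm (case x of (y, z) \<Rightarrow> h y * i z) \<le> R ^ Suc k"
        using space_g by (intro AE_I2) (auto simp: space_pair_measure split_def simp del: power_Suc)
      have "(\<lambda>p. h (fst p) * i (snd p)) \<in> borel_measurable (g \<Otimes>\<^sub>M g)"
        by (intro borel_measurable_times measurable_compose[OF measurable_fst h_meas]
            measurable_compose[OF measurable_snd i_meas])
      then show "(\<lambda>(y, z). h y * i z) \<in> borel_measurable (g \<Otimes>\<^sub>M g)"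
        by (simp add: split_def)
    qed
    have hi: "(\<integral>(y, z). h y * i z \<partial>(g \<Otimes>\<^sub>M g)) = (\<integral>x. h x \<partial>g) * measure g {0..a}"
    proof -
      have "(\<integral>z. i z \<partial>g) = (\<integral>z. indicator {0..a} z \<partial>g)"
        by (intro Bochner_Integration.integral_cong) (auto simp: i_def indicator_def space_g)
      also have "\<dots> = measure g {0..a}"
        using space_g by (simp add: Int_absorb2)
      finally show ?thesis
        using integral_fst[OF hi_int] by (simp add: mult.commute)
    qed
    have F_int: "integrable (g \<Otimes>\<^sub>M g) (\<lambda>(y, z). F y z)"
      and F: "b * (\<integral>x. x * ?\<theta> x \<partial>g) = (\<integral>z. (\<integral>y. F y z \<partial>g) \<partial>g)"
      using weak test_function_cutoff[OF continuous_on_capped_power[OF R], of k "2 * L"]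
      unfolding weak_solution_def F_def by auto
    have pair_ge: "C * (h y * i z + h z * i y) \<le> F y z + F z y" if yz: "0 \<le> z" "z \<le> y" for y z
    proof -
      have "continuous_on {0..} ?\<theta>"
        unfolding cutoff_def by (intro continuous_intros continuous_on_capped_power R)
      moreover have "0 \<le> ?\<theta> t" if "0 \<le> t" for t
        using capped_power_nonneg[OF R that] by (simp add: cutoff_def)
      ultimately have "0 \<le> average ?\<theta> y z" "0 \<le> average ?\<theta> z y"
        using yz by (intro average_nonneg; simp)+
      then have F_nonneg: "0 \<le> F y z" "0 \<le> F z y"
        unfolding F_def using yz K by simp_all
      show ?thesis
      proof (cases "z \<le> a \<and> y \<le> L")
        case True
        have eq: "?\<theta> t = capped_power k R t" if "t \<le> y + z" for t
          using that True yz by (simp add: cutoff_def)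
        have "h y * i z + h z * i y \<le> \<phi> y + \<phi> z"
          using h_bounds[of y] h_bounds[of z] yz by (auto simp: i_def indicator_def)
        then have "C * (h y * i z + h z * i y) \<le> C * (\<phi> y + \<phi> z)"
          using nonneg by (intro mult_left_mono)
        also have "\<dots> \<le> K y z * average (capped_power k R) y z
            + K z y * average (capped_power k R) z y"
          unfolding \<phi>_def using True yz by (intro dominates) auto
        also have "average (capped_power k R) y z = average ?\<theta> y z"
          using yz eq by (intro average_cong) auto
        also have "average (capped_power k R) z y = average ?\<theta> z y"
          using yz eq by (intro average_cong) auto
        finally show ?thesis by (simp add: F_def)
      next
        case False
        \<comment> \<open>If \<open>z > a\<close>, both indicators vanish because
          \<open>z \<le> y\<close>; if \<open>y > L\<close>, then \<open>h y = 0\<close>, and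
          \<open>i y = 0\<close> because \<open>a \<le> L\<close>.\<close>
        then have "h y * i z + h z * i y = 0"
          using yz \<open>a \<le> L\<close> by (auto simp: i_def h_def indicator_def)
        then show ?thesis using F_nonneg by simp
      qed
    qed
    let ?H = "\<lambda>p. h (fst p) * i (snd p)" and ?H' = "\<lambda>p. h (snd p) * i (fst p)"
    let ?F = "\<lambda>p. F (fst p) (snd p)" and ?F' = "\<lambda>p. F (snd p) (fst p)"
    have H_int: "integrable (g \<Otimes>\<^sub>M g) ?H" "integrable (g \<Otimes>\<^sub>M g) ?H'"
      using hi_int integrable_product_swap[OF hi_int] by (simp_all only: split_def fst_conv snd_conv)
    have F_int': "integrable (g \<Otimes>\<^sub>M g) ?F" "integrable (g \<Otimes>\<^sub>M g) ?F'"
      using F_int integrable_product_swap[OF F_int] by (simp_all only: split_def fst_conv snd_conv)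
    have H_swap: "(\<integral>p. ?H' p \<partial>(g \<Otimes>\<^sub>M g)) = (\<integral>p. ?H p \<partial>(g \<Otimes>\<^sub>M g))"
      using integral_product_swap[OF borel_measurable_integrable[OF H_int(1)]]
      by (simp only: split_def fst_conv snd_conv)
    have F_swap: "(\<integral>p. ?F' p \<partial>(g \<Otimes>\<^sub>M g)) = (\<integral>p. ?F p \<partial>(g \<Otimes>\<^sub>M g))"
      using integral_product_swap[OF borel_measurable_integrable[OF F_int'(1)]]
      by (simp only: split_def fst_conv snd_conv)
    \<comment> \<open>Each integral is doubled by adding its swapped copy; the copies agree because
      both factors of the product measure are \<open>g\<close>.\<close>
    have "2 * (C * measure g {0..a} * (\<integral>x. h x \<partial>g)) = C * (2 * (\<integral>p. ?H p \<partial>(g \<Otimes>\<^sub>M g)))"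
      using hi by (simp add: split_def)
    also have "\<dots> = C * (\<integral>p. ?H p + ?H' p \<partial>(g \<Otimes>\<^sub>M g))"
      unfolding Bochner_Integration.integral_add[OF H_int] H_swap by simp
    also have "\<dots> = (\<integral>p. C * (?H p + ?H' p) \<partial>(g \<Otimes>\<^sub>M g))"
      by (rule integral_mult_right_zero[symmetric])
    also have "\<dots> \<le> (\<integral>p. ?F p + ?F' p \<partial>(g \<Otimes>\<^sub>M g))"
    proof (rule integral_mono)
      show "integrable (g \<Otimes>\<^sub>M g) (\<lambda>p. C * (?H p + ?H' p))"
        by (intro integrable_mult_right Bochner_Integration.integrable_add H_int)
      show "integrable (g \<Otimes>\<^sub>M g) (\<lambda>p. ?F p + ?F' p)"
        by (intro Bochner_Integration.integrable_add F_int')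
      fix p assume "p \<in> space (g \<Otimes>\<^sub>M g)"
      then have p: "0 \<le> fst p" "0 \<le> snd p"
        unfolding space_pair_measure space_g by (simp_all add: mem_Times_iff)
      show "C * (?H p + ?H' p) \<le> ?F p + ?F' p"
      proof (cases "fst p \<le> snd p")
        case True
        show ?thesis using pair_ge[OF p(1) True] by (metis add.commute)
      next
        case False
        then have "snd p \<le> fst p" by simp
        then show ?thesis by (rule pair_ge[OF p(2)])
      qed
    qed
    also have "\<dots> = 2 * (\<integral>(y, z). F y z \<partial>(g \<Otimes>\<^sub>M g))"
      unfolding Bochner_Integration.integral_add[OF F_int'] F_swap by (simp add: split_def)
    also have "\<dots> = 2 * (b * (\<integral>x. x * ?\<theta> x \<partial>g))"
      using F integral_snd[OF F_int] by simp
    also have "\<dots> \<le> 2 * (b * (\<integral>x. \<phi> x \<partial>g))"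
    proof (intro mult_left_mono integral_mono')
      fix x assume "x \<in> space g"
      then have x: "0 \<le> x" using space_g by simp
      have *: "x * ?\<theta> x = \<phi> x * cutoff (2 * L) x"
        using mult_capped_power[OF R, of x k] unfolding \<phi>_def by (simp add: mult.assoc[symmetric])
      show "x * ?\<theta> x \<le> \<phi> x" unfolding *
        using \<phi>_bounds[OF x] by (intro mult_left_le) (auto simp: cutoff_def)
      show "0 \<le> \<phi> x" by (rule \<phi>_bounds[OF x])
    qed (use nonneg \<phi>_int in auto)
    finally show ?thesis by (simp add: h_def)
  qed
  \<comment> \<open>The upper bound does not depend on \<open>L\<close>, so the truncation in
    \<open>h\<close> is removed by dominated convergence with \<open>\<phi>\<close> as
    majorant.\<close>
  have "(\<lambda>n. \<integral>x. indicator {..real n} x * \<phi> x \<partial>g) \<longlonglongrightarrow> (\<integral>x. \<phi> x \<partial>g)"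
  proof (rule integral_dominated_convergence[where w = \<phi>])
    show "AE x in g. (\<lambda>n. indicator {..real n} x * \<phi> x) \<longlonglongrightarrow> \<phi> x"
    proof (intro AE_I2 tendsto_eventually)
      fix x :: real
      obtain N where "x \<le> real N" using real_arch_simple by blast
      then show "\<forall>\<^sub>F n in sequentially. indicator {..real n} x * \<phi> x = \<phi> x"
        by (intro eventually_sequentiallyI[of N]) (auto simp: indicator_def)
    qed
    show "AE x in g. norm (indicator {..real n} x * \<phi> x) \<le> \<phi> x" for n
      using \<phi>_bounds space_g by (intro AE_I2) (auto simp: indicator_def)
  qed (use \<phi>_int in auto)
  then have "(\<lambda>n. C * measure g {0..a} * (\<integral>x. indicator {..real n} x * \<phi> x \<partial>g))
      \<longlonglongrightarrow> C * measure g {0..a} * (\<integral>x. \<phi> x \<partial>g)"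
    by (intro tendsto_intros)
  moreover obtain N where "a \<le> real N" using real_arch_simple by blast
  ultimately have "C * measure g {0..a} * (\<integral>x. \<phi> x \<partial>g) \<le> b * (\<integral>x. \<phi> x \<partial>g)"
    using bound by (intro LIMSEQ_le_const2) (auto intro!: exI[of _ N])
  then show ?thesis by (simp only: \<phi>_def)
qed

section \<open>Concentration at the origin\<close>

text \<open>A measurable set agrees almost everywhere with the whole space or with the empty set,
  according to whether it contains 0.\<close>

lemma eq_delta0I:
  assumes sets_g: "sets g = sets half_line" and prob: "prob_space g" and AE: "AE x in g. x = 0"
  shows "g = delta0"
  unfolding delta0_def
proof (rule measure_eqI)
  show "sets g = sets (return half_line 0)" using sets_g by simp
  fix A assume A: "A \<in> sets g"
  interpret prob_space g by (fact prob)
  have "emeasure g A = emeasure g (if 0 \<in> A then space g else {})"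
    using AE A by (intro emeasure_eq_AE) auto
  also have "\<dots> = indicator A 0" by (simp add: emeasure_space_1)
  finally show "emeasure g A = emeasure (return half_line 0) A"
    using A sets_g by simp
qed

text \<open>As \<open>R\<close> grows, the mass of \<open>{0..\<epsilon> * R / 2}\<close> tends to
  the total mass 1, so by the strict bound on \<open>b\<close> a single finite \<open>R\<close>
  already makes the left coefficient in the moment inequality exceed \<open>b\<close>. The capped
  moment for this \<open>R\<close> then vanishes, and its integrand is positive away from 0.\<close>

lemma weak_solution_eq_delta0:
  fixes K :: "real \<Rightarrow> real \<Rightarrow> real"
  assumes sym: "\<And>x y. 0 \<le> x \<Longrightarrow> 0 \<le> y \<Longrightarrow> K x y = K y x \<and> 0 \<le> K x y"
    and near: "\<And>x s. 0 < x \<Longrightarrow> 0 \<le> s \<Longrightarrow> s \<le> \<epsilon> * x \<Longrightarrow> x + s \<le> K x s"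
    and below: "\<And>x s. 0 < x \<Longrightarrow> 0 < s \<Longrightarrow> k\<^sub>0 * x \<le> K x s"
    and \<epsilon>: "0 < \<epsilon>" "\<epsilon> \<le> 1/2" and k0: "0 < k\<^sub>0"
    and k: "4 * real (Suc k) \<le> k\<^sub>0 * (1 + \<epsilon>) ^ k" "\<epsilon> ^ Suc k \<le> 1 / (8 * real (Suc k))"
    and b: "0 \<le> b" "b < 1 + 1 / (4 * real (Suc k))"
    and sets_g: "sets g = sets half_line" and mass: "emeasure g {0..} = 1"
    and weak: "weak_solution K b g"
  shows "g = delta0"
proof -
  have space_g: "space g = {0..}" by (rule space_eq_half_line[OF sets_g])
  have prob: "prob_space g" using mass space_g by (intro prob_spaceI) simp
  interpret prob_space g by (fact prob)
  note [measurable] = measurable_ident_half_line[OF sets_g]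
  let ?C = "1 + 1 / (4 * real (Suc k))"
  \<comment> \<open>The cap \<open>R\<close> runs through the positive integers
    \<open>Suc n\<close>, giving increasing intervals that exhaust the half-line.\<close>
  have "(\<lambda>n. measure g {0..\<epsilon> * real (Suc n) / 2}) \<longlonglongrightarrow> measure g (\<Union>n. {0..\<epsilon> * real (Suc n) / 2})"
  proof (rule finite_Lim_measure_incseq)
    have "{0..r} \<in> sets g" for r :: real
      unfolding sets_g by (auto simp: sets_restrict_space_iff)
    then show "range (\<lambda>n. {0..\<epsilon> * real (Suc n) / 2}) \<subseteq> sets g" by auto
    show "incseq (\<lambda>n. {0..\<epsilon> * real (Suc n) / 2})"
      using \<epsilon> by (auto simp: incseq_def intro: order_trans mult_left_mono)
  qed
  moreover have "(\<Union>n. {0..\<epsilon> * real (Suc n) / 2}) = space g"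
  proof -
    have "\<exists>n. x \<le> \<epsilon> * real (Suc n) / 2" for x
    proof -
      obtain n where "2 * x / \<epsilon> \<le> real n" using real_arch_simple by blast
      then show ?thesis using \<epsilon> by (intro exI[of _ n]) (simp add: field_simps)
    qed
    then show ?thesis using space_g by auto
  qed
  ultimately have "(\<lambda>n. ?C * measure g {0..\<epsilon> * real (Suc n) / 2}) \<longlonglongrightarrow> ?C * 1"
    using prob_space by (intro tendsto_intros) simp
  then have "\<forall>\<^sub>F n in sequentially. b < ?C * measure g {0..\<epsilon> * real (Suc n) / 2}"
    using b by (intro order_tendstoD) auto
  then obtain n where n: "b < ?C * measure g {0..\<epsilon> * real (Suc n) / 2}"
    using eventually_happens trivial_limit_sequentially by blast
  define R where "R = real (Suc n)"
  have R: "0 < R" by (simp add: R_def)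
  let ?I = "\<integral>x. min x R ^ Suc k \<partial>g"
  have le: "?C * measure g {0..\<epsilon> * R / 2} * ?I \<le> b * ?I"
  proof (rule weak_solution_capped_moment_ge[OF sets_g prob weak])
    show "?C * (min x R ^ Suc k + min s R ^ Suc k)
      \<le> K x s * average (capped_power k R) x s + K s x * average (capped_power k R) s x"
      if "0 \<le> s" "s \<le> x" "s \<le> \<epsilon> * R / 2" for x s
      using capped_power_dominates[OF sym near below \<epsilon> k0 k that R] by blast
  qed (use sym b \<epsilon> R in auto)
  have nonneg: "0 \<le> min x R ^ Suc k" if "x \<in> space g" for x
    using that space_g R by (intro zero_le_power) simp
  \<comment> \<open>A positive moment could be cancelled from \<open>le\<close>, contradicting the
    choice of \<open>n\<close>.\<close>
  have "?I \<le> 0"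
    using le n unfolding R_def[symmetric] by (metis mult_le_cancel_right not_le)
  then have "?I = 0" using nonneg by (intro antisym integral_nonneg_AE AE_I2)
  moreover have "integrable g (\<lambda>x. min x R ^ Suc k)"
  proof (rule integrable_const_bound[of _ "R ^ Suc k"])
    have "norm (min x R ^ Suc k) \<le> R ^ Suc k" if "x \<in> space g" for x
    proof -
      have "min x R ^ Suc k \<le> R ^ Suc k"
        using that space_g R by (intro power_mono) simp_all
      then show ?thesis using nonneg[OF that] unfolding real_norm_def by linarith
    qed
    then show "AE x in g. norm (min x R ^ Suc k) \<le> R ^ Suc k" by (rule AE_I2)
  qed measurable
  ultimately have "AE x in g. min x R ^ Suc k = 0"
    using nonneg by (subst integral_nonneg_eq_0_iff_AE[symmetric]) auto
  then have "AE x in g. x = 0"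
    by eventually_elim (use R in \<open>auto simp: min_def split: if_splits\<close>)
  then show ?thesis by (rule eq_delta0I[OF sets_g prob])
qed

section \<open>The Dirac delta is a weak solution\<close>

text \<open>With a primitive \<open>\<Theta>\<close> of \<open>\<theta>\<close> the average becomes
  the difference quotient \<open>(\<Theta> (y + z) - \<Theta> y) / z\<close>, a measurable
  expression in the pair, glued to \<open>\<theta> y\<close> on the measurable set
  \<open>z = 0\<close>.\<close>

lemma measurable_average:
  assumes \<theta>: "continuous_on {0..} \<theta>"
  shows "(\<lambda>(y, z). average \<theta> y z) \<in> borel_measurable (half_line \<Otimes>\<^sub>M half_line)"
proof -
  define \<Theta> where "\<Theta> x = integral {0..x} \<theta>" for x
  have \<Theta>: "continuous_on {0..} \<Theta>"
  proof -
    \<comment> \<open>Continuity is local, so it is read off the compact interval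
      \<open>{0..x + 1}\<close>, a neighbourhood of \<open>x\<close> within the half-line.\<close>
    have "continuous (at x within {0..}) \<Theta>" if "0 \<le> x" for x
    proof -
      have "\<theta> integrable_on {0..x + 1}"
        using \<theta> by (intro integrable_continuous_interval) (auto intro: continuous_on_subset)
      then have "continuous_on {0..x + 1} \<Theta>"
        unfolding \<Theta>_def by (rule indefinite_integral_continuous_1)
      then have "continuous (at x within {0..x + 1}) \<Theta>"
        using that by (simp add: continuous_on_eq_continuous_within)
      moreover have "at x within {0..} = at x within {0..x + 1}"
        by (rule at_within_nhd[of x "{..<x + 1}"]) auto
      ultimately show ?thesis by simp
    qed
    then show ?thesis by (simp add: continuous_on_eq_continuous_within)
  qed
  have [measurable]: "(\<lambda>x. x) \<in> measurable half_line borel"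
    by (rule measurable_ident_half_line) simp
  have [measurable]: "\<theta> \<in> borel_measurable half_line" "\<Theta> \<in> borel_measurable half_line"
    using \<theta> \<Theta> by (auto intro: borel_measurable_continuous_on_restrict)
  have add [measurable]: "(\<lambda>(y, z). y + z) \<in> measurable (half_line \<Otimes>\<^sub>M half_line) half_line"
    by (rule measurable_restrict_space2) (auto simp: space_pair_measure space_restrict_space)
  have [measurable]: "(\<lambda>p. \<Theta> (fst p + snd p)) \<in> borel_measurable (half_line \<Otimes>\<^sub>M half_line)"
    using measurable_compose[OF add \<open>\<Theta> \<in> borel_measurable half_line\<close>] by (simp add: split_def)
  have "(\<lambda>p. if snd p = 0 then \<theta> (fst p) else 1 / snd p * (\<Theta> (fst p + snd p) - \<Theta> (fst p)))
    \<in> borel_measurable (half_line \<Otimes>\<^sub>M half_line)"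
    by measurable
  then show ?thesis
  proof (rule measurable_cong[THEN iffD1, rotated])
    fix p assume "p \<in> space (half_line \<Otimes>\<^sub>M half_line)"
    then have p: "0 \<le> fst p" "0 \<le> snd p" by (auto simp: space_pair_measure space_restrict_space)
    have "\<theta> integrable_on {0..fst p + snd p}"
      using \<theta> by (intro integrable_continuous_interval) (auto intro: continuous_on_subset)
    then have "\<Theta> (fst p) + integral {fst p..fst p + snd p} \<theta> = \<Theta> (fst p + snd p)"
      (is "_ + ?int = _")
      unfolding \<Theta>_def using p by (intro Henstock_Kurzweil_Integration.integral_combine) auto
    then have "?int = \<Theta> (fst p + snd p) - \<Theta> (fst p)" by linarith
    then show "(if snd p = 0 then \<theta> (fst p) else 1 / snd p * (\<Theta> (fst p + snd p) - \<Theta> (fst p)))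
        = (case p of (y, z) \<Rightarrow> average \<theta> y z)"
      by (auto simp: average_def split_def)
  qed
qed

text \<open>Precomposing with \<open>max 0\<close> in each variable extends \<open>K\<close>
  continuously from the quadrant to the whole plane, where continuity gives Borel
  measurability.\<close>

lemma measurable_kernel:
  fixes K :: "real \<Rightarrow> real \<Rightarrow> real"
  assumes "continuous_on ({0..} \<times> {0..}) (\<lambda>(x, y). K x y)"
  shows "(\<lambda>(y, z). K y z) \<in> borel_measurable (half_line \<Otimes>\<^sub>M half_line)"
proof -
  have [measurable]: "(\<lambda>x. x) \<in> measurable half_line borel"
    by (rule measurable_ident_half_line) simp
  have "continuous_on UNIV ((\<lambda>(x, y). K x y) \<circ> (\<lambda>p. (max 0 (fst p), max 0 (snd p))))"
    by (rule continuous_on_compose)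
      (auto intro!: continuous_intros continuous_on_subset[OF assms])
  then have "(\<lambda>(x, y). K x y) \<circ> (\<lambda>p. (max 0 (fst p), max 0 (snd p)))
      \<in> borel_measurable (borel \<Otimes>\<^sub>M borel)"
    unfolding borel_prod by (rule borel_measurable_continuous_onI)
  moreover have "(\<lambda>p. (fst p, snd p)) \<in> measurable (half_line \<Otimes>\<^sub>M half_line) (borel \<Otimes>\<^sub>M borel)"
    by measurable
  ultimately have "(\<lambda>p. ((\<lambda>(x, y). K x y) \<circ> (\<lambda>p. (max 0 (fst p), max 0 (snd p)))) (fst p, snd p))
      \<in> borel_measurable (half_line \<Otimes>\<^sub>M half_line)"
    by (rule measurable_compose[rotated])
  then show ?thesis
    by (rule measurable_cong[THEN iffD1, rotated])
      (auto simp: space_pair_measure space_restrict_space)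
qed

lemma prob_space_delta0: "prob_space delta0"
  unfolding delta0_def by (rule prob_space_return) (simp add: space_restrict_space)

lemma sets_delta0: "sets delta0 = sets half_line"
  by (simp add: delta0_def)

lemma delta0_in_radon_measures: "delta0 \<in> radon_measures"
proof -
  interpret prob_space delta0 by (rule prob_space_delta0)
  show ?thesis by (auto simp: radon_measures_def sets_delta0 less_top[symmetric])
qed

text \<open>The product measure sits at the point (0, 0), where \<open>K\<close> vanishes, and
  \<open>x * \<theta> x\<close> vanishes at 0, so both sides are 0. Integrability belongs to the
  notion of weak solution, hence the measurability of the integrand is established first.\<close>

lemma weak_solution_delta0:
  fixes K :: "real \<Rightarrow> real \<Rightarrow> real"
  assumes cont: "continuous_on ({0..} \<times> {0..}) (\<lambda>(x, y). K x y)" and K00: "K 0 0 = 0"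
  shows "weak_solution K b delta0"
  unfolding weak_solution_def
proof (intro allI impI conjI)
  fix \<theta> assume "test_function \<theta>"
  then have \<theta>: "continuous_on {0..} \<theta>" by (simp add: test_function_def)
  define F where "F y z = K y z * average \<theta> y z" for y z
  interpret prob_space delta0 by (rule prob_space_delta0)
  interpret pair_sigma_finite delta0 delta0 ..
  have space: "0 \<in> space half_line" by (simp add: space_restrict_space)
  have F [measurable]: "(\<lambda>(y, z). F y z) \<in> borel_measurable (half_line \<Otimes>\<^sub>M half_line)"
    unfolding F_def using borel_measurable_times[OF measurable_kernel[OF cont] measurable_average[OF \<theta>]]
    by (simp add: split_def)
  have F': "(\<lambda>(y, z). F y z) \<in> borel_measurable (delta0 \<Otimes>\<^sub>M delta0)"
    using F by (subst measurable_cong_sets[OF sets_pair_measure_cong[OF sets_delta0 sets_delta0] refl])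
  have F00: "F 0 0 = 0" by (simp add: F_def K00)
  have AE0: "AE x in delta0. x = 0"
  proof -
    have [measurable]: "(\<lambda>x. x) \<in> borel_measurable half_line"
      by (rule measurable_ident_half_line) simp
    show ?thesis unfolding delta0_def by (subst AE_return[OF space]) auto
  qed
  have "AE p in delta0 \<Otimes>\<^sub>M delta0. (case p of (y, z) \<Rightarrow> F y z) = 0"
  proof (rule AE_pair_measure)
    show "{p \<in> space (delta0 \<Otimes>\<^sub>M delta0). (case p of (y, z) \<Rightarrow> F y z) = 0} \<in> sets (delta0 \<Otimes>\<^sub>M delta0)"
      using F' by measurable
    show "AE y in delta0. AE z in delta0. (case (y, z) of (y, z) \<Rightarrow> F y z) = 0"
      using AE0
    proof eventually_elim
      case (elim y)
      show ?case using AE0 by eventually_elim (use elim F00 in auto)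
    qed
  qed
  then show "integrable (delta0 \<Otimes>\<^sub>M delta0) (\<lambda>(y, z). K y z * average \<theta> y z)"
    using F' unfolding F_def[symmetric] by (subst integrable_cong_AE[where g = "\<lambda>_. 0"]) auto
  have "(\<integral>x. x * \<theta> x \<partial>delta0) = 0"
    by (rule integral_eq_zero_AE) (use AE0 in eventually_elim, auto)
  moreover have "(\<integral>z. (\<integral>y. F y z \<partial>delta0) \<partial>delta0) = 0"
  proof (rule integral_eq_zero_AE)
    show "AE z in delta0. (\<integral>y. F y z \<partial>delta0) = 0"
      using AE0
    proof eventually_elim
      case (elim z)
      show ?case
        by (rule integral_eq_zero_AE) (use AE0 in eventually_elim, use elim F00 in auto)
    qed
  qed
  ultimately show "b * (\<integral>x. x * \<theta> x \<partial>delta0)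
      = (\<integral>z. (\<integral>y. K y z * average \<theta> y z \<partial>delta0) \<partial>delta0)"
    by (simp add: F_def)
qed

text \<open>Homogeneity does not reach the origin directly; the value is the limit of
  \<open>K t t = t * K 1 1\<close> along the diagonal.\<close>

lemma kernel_zero_zero:
  fixes K :: "real \<Rightarrow> real \<Rightarrow> real"
  assumes cont: "continuous_on ({0..} \<times> {0..}) (\<lambda>(x, y). K x y)"
    and hom: "\<And>a x y. 0 < a \<Longrightarrow> 0 < x \<Longrightarrow> 0 < y \<Longrightarrow> K (a * x) (a * y) = a * K x y"
  shows "K 0 0 = 0"
proof -
  have "continuous_on {0..} ((\<lambda>(x, y). K x y) \<circ> (\<lambda>t. (t, t)))"
    by (rule continuous_on_compose)
      (auto intro!: continuous_intros continuous_on_subset[OF cont])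
  then have "((\<lambda>t. K t t) \<longlongrightarrow> K 0 0) (at 0 within {0..})"
    by (simp add: continuous_on o_def)
  then have "((\<lambda>t. K t t) \<longlongrightarrow> K 0 0) (at_right 0)"
    by (rule tendsto_within_subset) auto
  moreover have "((\<lambda>t. K t t) \<longlongrightarrow> 0) (at_right 0)"
  proof (rule Lim_transform_eventually)
    show "((\<lambda>t. t * K 1 1) \<longlongrightarrow> 0) (at_right 0)" by (auto intro!: tendsto_eq_intros)
    show "\<forall>\<^sub>F t in at_right 0. t * K 1 1 = K t t"
      using eventually_at_right_less[of "0::real"]
    proof eventually_elim
      case (elim t)
      then show ?case using hom[of t 1 1] by simp
    qed
  qed
  ultimately show ?thesis by (intro tendsto_unique[of "at_right 0"]) auto
qed

section \<open>Uniqueness and existence for large \<open>\<rho>\<close>\<close>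

theorem theorem1p2:
  fixes K :: "real \<Rightarrow> real \<Rightarrow> real" and \<beta>\<^sub>0 \<alpha> k\<^sub>0 \<rho>\<^sub>s :: real
  assumes "continuous_on ({0..} \<times> {0..}) (\<lambda>(x, y). K x y)"
    and "\<And>x y. 0 \<le> x \<Longrightarrow> 0 \<le> y \<Longrightarrow> K x y = K y x \<and> 0 \<le> K x y"
    and "\<And>a x y. 0 < a \<Longrightarrow> 0 < x \<Longrightarrow> 0 < y \<Longrightarrow> K (a * x) (a * y) = a * K x y"
    and "0 < \<beta>\<^sub>0" and "0 < \<alpha>" and "\<alpha> < 1"
    and "((\<lambda>\<xi>. (K 1 \<xi> - 1) / \<xi> powr \<alpha>) \<longlongrightarrow> \<beta>\<^sub>0) (at_right 0)"
    and "0 < k\<^sub>0" and "\<And>\<xi>. 0 \<le> \<xi> \<Longrightarrow> k\<^sub>0 \<le> K 1 \<xi>"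
    and "0 < \<rho>\<^sub>s" and "rho_star_property K \<rho>\<^sub>s"
  shows "\<exists>\<rho>\<^sub>s\<^sub>s\<ge>\<rho>\<^sub>s. \<forall>\<rho>>\<rho>\<^sub>s\<^sub>s. \<forall>g.
    (g \<in> radon_measures \<and> weak_solution K ((1 + \<rho>) / \<rho>) g \<and> emeasure g {0..} = 1)
      \<longleftrightarrow> g = delta0"
proof -
  obtain \<epsilon> where \<epsilon>: "0 < \<epsilon>" "\<epsilon> \<le> 1/2"
    and near: "\<And>x s. 0 < x \<Longrightarrow> 0 \<le> s \<Longrightarrow> s \<le> \<epsilon> * x \<Longrightarrow> x + s \<le> K x s"
    using kernel_ge_sum_near_axis[OF assms(1) assms(3) assms(4) assms(6) assms(7)] by blast
  obtain k :: nat where k: "4 * real (Suc k) \<le> k\<^sub>0 * (1 + \<epsilon>) ^ k"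
      "\<epsilon> ^ Suc k \<le> 1 / (8 * real (Suc k))"
    using exponent_exists[OF \<epsilon> assms(8)] by blast
  have below: "k\<^sub>0 * x \<le> K x s" if "0 < x" "0 < s" for x s
    using assms(3)[of x 1 "s / x"] assms(9)[of "s / x"] that by (simp add: mult.commute)
  show ?thesis
  \<comment> \<open>The first entry of the maximum keeps the threshold above
    \<open>\<rho>\<^sub>s\<close>; the second turns \<open>\<rho> > 4 * real (Suc k)\<close> into
    the strict bound on \<open>b = 1 + 1 / \<rho>\<close>.\<close>
  proof (intro exI[of _ "max \<rho>\<^sub>s (4 * real (Suc k))"] conjI allI impI)
    fix \<rho> g assume "max \<rho>\<^sub>s (4 * real (Suc k)) < \<rho>"
    then have \<rho>: "0 < \<rho>" "4 * real (Suc k) < \<rho>" using assms(10) by auto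
    have "1 / \<rho> < 1 / (4 * real (Suc k))" using \<rho> by (intro divide_strict_left_mono) auto
    then have b: "(1 + \<rho>) / \<rho> < 1 + 1 / (4 * real (Suc k))"
      using \<rho> by (simp add: add_divide_distrib)
    show "(g \<in> radon_measures \<and> weak_solution K ((1 + \<rho>) / \<rho>) g \<and> emeasure g {0..} = 1)
      \<longleftrightarrow> g = delta0" (is "?L \<longleftrightarrow> _")
    proof
      assume ?L
      then show "g = delta0"
        using weak_solution_eq_delta0[OF assms(2) near below \<epsilon> assms(8) k _ b] \<rho>
        by (auto simp: radon_measures_def)
    next
      \<comment> \<open>The equivalence contains existence as well, so \<open>delta0\<close> itself
        is checked here.\<close>
      assume "g = delta0"
      moreover have "emeasure delta0 {0..} = 1"
        using prob_space.emeasure_space_1[OF prob_space_delta0] space_eq_half_line[OF sets_delta0]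
        by simp
      ultimately show ?L
        using delta0_in_radon_measures
          weak_solution_delta0[OF assms(1) kernel_zero_zero[OF assms(1,3)]] by simp
    qed
  qed simp
qed

end
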